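(* A connected graph $G$ with minimum degree at least $2$ is single conflict $2$-colorable if and only if $G$ consists of two or three internally disjoint paths connecting two distinct vertices of $G$.
   Context: Graphs are finite and simple. A local $k$-partition of a graph $G$ is a collection $\{c_v\}_{v\in V(G)}$ of maps $c_v : E(v)\to\{1,\dots,k\}$, where $E(v)$ is the set of edges incident with $v$. $G$ is conflict $\{c_v\}$-colorable if there is a map $\varphi : V(G)\to\{1,\dots,k\}$ such that no edge $e=xy$ satisfies both $\varphi(x)=c_x(e)$ and $\varphi(y)=c_y(e)$. $G$ is single conflict $k$-colorable if it is conflict $\{c_v\}$-colorable for every local $k$-partition $\{c_v\}$. "$G$ consists of two or three internally disjoint paths connecting two distinct vertices" means that there are distinct vertices $a,b$ of $G$ such that $G$ is the union of two or three distinct $a$–$b$ paths, which pairwise share only the vertices $a$ and $b$. *)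

theory Defs
  imports Main
begin

text \<open>
  A graph is given by its vertex set \<open>V\<close> and its edge set \<open>E\<close>; an edge is the two-element set of
  its ends, so loops and parallel edges do not exist.
\<close>

definition simple_graph :: "'a set \<Rightarrow> 'a set set \<Rightarrow> bool" where
  "simple_graph V E \<longleftrightarrow> finite V \<and> (\<forall>e\<in>E. e \<subseteq> V \<and> card e = 2)"

definition incident_edges :: "'a set set \<Rightarrow> 'a \<Rightarrow> 'a set set" where
  "incident_edges E v = {e \<in> E. v \<in> e}"

definition vertex_degree :: "'a set set \<Rightarrow> 'a \<Rightarrow> nat" where
  "vertex_degree E v = card (incident_edges E v)"

text \<open>Only meaningful for finite nonempty \<open>V\<close>.\<close>

definition min_degree :: "'a set \<Rightarrow> 'a set set \<Rightarrow> nat" where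
  "min_degree V E = Min (vertex_degree E ` V)"

text \<open>
  A path is the list of its vertices, read from the first end to the second. Since the ends are
  ordered, distinct lists with the same ends \<open>a \<noteq> b\<close> are distinct paths.
\<close>

definition path_edges :: "'a list \<Rightarrow> 'a set set" where
  "path_edges p = {{p ! i, p ! Suc i} | i. Suc i < length p}"

definition is_path :: "'a set \<Rightarrow> 'a set set \<Rightarrow> 'a \<Rightarrow> 'a \<Rightarrow> 'a list \<Rightarrow> bool" where
  "is_path V E a b p \<longleftrightarrow>
     p \<noteq> [] \<and> hd p = a \<and> last p = b \<and> distinct p \<and> set p \<subseteq> V \<and> path_edges p \<subseteq> E"

text \<open>The graph without vertices is not regarded as connected.\<close>

definition graph_connected :: "'a set \<Rightarrow> 'a set set \<Rightarrow> bool" where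
  "graph_connected V E \<longleftrightarrow> V \<noteq> {} \<and> (\<forall>u\<in>V. \<forall>v\<in>V. \<exists>p. is_path V E u v p)"

definition local_partition ::
  "'a set \<Rightarrow> 'a set set \<Rightarrow> nat \<Rightarrow> ('a \<Rightarrow> 'a set \<Rightarrow> nat) \<Rightarrow> bool" where
  "local_partition V E k c \<longleftrightarrow> (\<forall>v\<in>V. \<forall>e\<in>incident_edges E v. c v e \<in> {1..k})"

definition conflict_colorable ::
  "'a set \<Rightarrow> 'a set set \<Rightarrow> nat \<Rightarrow> ('a \<Rightarrow> 'a set \<Rightarrow> nat) \<Rightarrow> bool" where
  "conflict_colorable V E k c \<longleftrightarrow>
     (\<exists>\<phi>. (\<forall>v\<in>V. \<phi> v \<in> {1..k}) \<and>
          \<not> (\<exists>x y. {x, y} \<in> E \<and> \<phi> x = c x {x, y} \<and> \<phi> y = c y {x, y}))"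

definition single_conflict_colorable :: "'a set \<Rightarrow> 'a set set \<Rightarrow> nat \<Rightarrow> bool" where
  "single_conflict_colorable V E k \<longleftrightarrow>
     (\<forall>c. local_partition V E k c \<longrightarrow> conflict_colorable V E k c)"

definition two_or_three_disjoint_paths :: "'a set \<Rightarrow> 'a set set \<Rightarrow> bool" where
  "two_or_three_disjoint_paths V E \<longleftrightarrow>
     (\<exists>a\<in>V. \<exists>b\<in>V. a \<noteq> b \<and>
       (\<exists>P. card P \<in> {2, 3} \<and>
            (\<forall>p\<in>P. is_path V E a b p) \<and>
            (\<forall>p\<in>P. \<forall>q\<in>P. p \<noteq> q \<longrightarrow> set p \<inter> set q = {a, b}) \<and>
            V = (\<Union>p\<in>P. set p) \<and>
            E = (\<Union>p\<in>P. path_edges p)))"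

end

theory Submission
  imports Defs
begin

text \<open>
  With two colours, a local partition is a 2-SAT instance with one clause on the ends of each edge.
  A path can be made to propagate any prescribed colours from its first vertex to all its vertices.
  Hence a cycle can force the colour of any one of its vertices, and a theta graph can force the
  colours of any two of its vertices. A cycle with a lollipop attached, or a theta graph with an
  ear or a lollipop attached, therefore carries an unsatisfiable instance; by maximal paths, a
  connected graph of minimum degree at least 2 contains one of these unless it is a cycle or a
  theta graph. Conversely, each path between \<open>a\<close> and \<open>b\<close> excludes at most one of the four pairs of
  colours of \<open>a\<close> and \<open>b\<close>, so up to three internally disjoint paths leave a pair that extends.
\<close>

section \<open>Edges of paths\<close>

lemma path_edges_Nil [simp]: "path_edges [] = {}"
  by (simp add: path_edges_def)

lemma path_edges_single [simp]: "path_edges [x] = {}"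
  by (simp add: path_edges_def)

lemma path_edges_Cons_Cons [simp]:
  "path_edges (x # y # zs) = insert {x, y} (path_edges (y # zs))"
proof (rule set_eqI)
  fix e
  have "e \<in> path_edges (x # y # zs) \<longleftrightarrow>
      (\<exists>i. e = {(x # y # zs) ! i, (x # y # zs) ! Suc i} \<and> Suc i < length (x # y # zs))"
    by (auto simp: path_edges_def)
  also have "\<dots> \<longleftrightarrow> e = {x, y} \<or>
      (\<exists>i. e = {(y # zs) ! i, (y # zs) ! Suc i} \<and> Suc i < length (y # zs))"
    (is "?L \<longleftrightarrow> ?R")
  proof
    assume ?L
    then obtain i where "e = {(x # y # zs) ! i, (x # y # zs) ! Suc i}" "Suc i < length (x # y # zs)"
      by blast
    then show ?R by (cases i) auto
  next
    assume ?R
    then show ?L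
    proof
      assume "e = {x, y}"
      then show ?L by (intro exI[of _ 0]) simp
    next
      assume "\<exists>i. e = {(y # zs) ! i, (y # zs) ! Suc i} \<and> Suc i < length (y # zs)"
      then obtain i where "e = {(y # zs) ! i, (y # zs) ! Suc i}" "Suc i < length (y # zs)" by blast
      then show ?L by (intro exI[of _ "Suc i"]) simp
    qed
  qed
  also have "\<dots> \<longleftrightarrow> e \<in> insert {x, y} (path_edges (y # zs))"
    by (auto simp: path_edges_def)
  finally show "e \<in> path_edges (x # y # zs) \<longleftrightarrow> e \<in> insert {x, y} (path_edges (y # zs))" .
qed

lemma path_edges_append:
  "xs \<noteq> [] \<Longrightarrow> ys \<noteq> [] \<Longrightarrow>
    path_edges (xs @ ys) = path_edges xs \<union> path_edges ys \<union> {{last xs, hd ys}}"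
proof (induction xs)
  case (Cons x xs)
  then show ?case by (cases xs; cases ys) auto
qed simp

lemma path_edges_rev [simp]: "path_edges (rev xs) = path_edges xs"
proof (induction xs)
  case (Cons x xs)
  show ?case
  proof (cases xs)
    case (Cons y ys)
    then show ?thesis
      using path_edges_append[of "rev xs" "[x]"] Cons.IH
      by (simp add: last_rev insert_commute)
  qed simp
qed simp

lemma path_edges_split:
  "path_edges (xs @ u # ys) = path_edges (xs @ [u]) \<union> path_edges (u # ys)"
  by (cases "xs = []") (auto simp: path_edges_append)

lemma path_edges_subset_set: "e \<in> path_edges xs \<Longrightarrow> e \<subseteq> set xs"
  by (auto simp: path_edges_def)

lemma card_path_edge: "distinct xs \<Longrightarrow> e \<in> path_edges xs \<Longrightarrow> card e = 2"
  by (auto simp: path_edges_def nth_eq_iff_index_eq)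

lemma path_edge_at_vertex:
  "v \<in> set xs \<Longrightarrow> length xs \<ge> 2 \<Longrightarrow> \<exists>e\<in>path_edges xs. v \<in> e"
proof (induction xs)
  case (Cons x xs)
  then obtain y ys where xs: "xs = y # ys" by (cases xs) auto
  show ?case
  proof (cases "v \<in> {x, y}")
    case False
    with Cons.prems xs have "v \<in> set ys" by auto
    with xs have "length xs \<ge> 2" by (cases ys) auto
    with Cons.IH Cons.prems False xs show ?thesis by auto
  qed (use xs in auto)
qed simp

text \<open>The first vertex lies on the first edge only, so \<open>last p\<close> is the second
  vertex, and distinctness ends the list there.\<close>

lemma ends_adjacent_on_path:
  assumes "distinct p" "p \<noteq> []" "hd p \<noteq> last p" "{hd p, last p} \<in> path_edges p"
  shows "p = [hd p, last p]"
proof -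
  obtain x y zs where p: "p = x # y # zs"
    using assms(2,3) by (cases p; cases "tl p") auto
  with assms(1) have "{x, last p} \<notin> path_edges (y # zs)"
    using path_edges_subset_set by fastforce
  with assms(4) p have "last p = y" by (auto simp: doubleton_eq_iff)
  with assms(1) p have "zs = []" using last_in_set[of zs] by (cases "zs = []") auto
  with p show ?thesis by simp
qed

lemma path_leaves_set:
  "p \<noteq> [] \<Longrightarrow> hd p \<in> W \<Longrightarrow> last p \<notin> W \<Longrightarrow> \<exists>x\<in>W. \<exists>y. y \<notin> W \<and> {x, y} \<in> path_edges p"
proof (induction p)
  case (Cons x p)
  then obtain y ys where p: "p = y # ys" by (cases p) auto
  show ?case
  proof (cases "y \<in> W")
    case True
    with Cons p show ?thesis by auto
  next
    case False
    with Cons.prems p show ?thesis by auto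
  qed
qed simp

section \<open>Two colours\<close>

text \<open>A two-element type in place of the numbers 1 and 2: every colour has a complement, and
  no range condition has to be carried along.\<close>

datatype colour = One | Two

primrec other :: "colour \<Rightarrow> colour" where
  "other One = Two"
| "other Two = One"

lemma eq_other_iff: "s = other t \<longleftrightarrow> s \<noteq> t"
  by (cases s; cases t) auto

lemma other_neq [simp]: "other s \<noteq> s"
  by (cases s) simp_all

section \<open>Clauses on edges and the relations they enforce\<close>

definition violates :: "('a \<Rightarrow> 'a set \<Rightarrow> colour) \<Rightarrow> ('a \<Rightarrow> colour) \<Rightarrow> 'a \<Rightarrow> 'a \<Rightarrow> bool" where
  "violates c \<phi> x y \<longleftrightarrow> \<phi> x = c x {x, y} \<and> \<phi> y = c y {x, y}"

definition satisfies :: "'a set set \<Rightarrow> ('a \<Rightarrow> 'a set \<Rightarrow> colour) \<Rightarrow> ('a \<Rightarrow> colour) \<Rightarrow> bool" where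
  "satisfies F c \<phi> \<longleftrightarrow> (\<forall>x y. {x, y} \<in> F \<longrightarrow> \<not> violates c \<phi> x y)"

text \<open>The local partition \<open>c\<close> may be chosen freely, so this describes what the
  edges of \<open>F\<close> can be made to force. With \<open>R\<close> constantly false it states
  that some instance on \<open>F\<close> is unsatisfiable.\<close>

definition imposes :: "'a set set \<Rightarrow> (('a \<Rightarrow> colour) \<Rightarrow> bool) \<Rightarrow> bool" where
  "imposes F R \<longleftrightarrow> (\<exists>c. \<forall>\<phi>. satisfies F c \<phi> \<longrightarrow> R \<phi>)"

lemma single_conflict_2_colorable_iff:
  assumes "simple_graph V E"
  shows "single_conflict_colorable V E 2 \<longleftrightarrow> \<not> imposes E (\<lambda>_. False)"
proof -
  define to_nat :: "colour \<Rightarrow> nat" where "to_nat = case_colour 1 2"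
  define of_num :: "nat \<Rightarrow> colour" where "of_num n = (if n = 1 then One else Two)" for n
  have to_nat: "to_nat s \<in> {1..2}" for s by (cases s) (auto simp: to_nat_def)
  have of_to: "of_num (to_nat s) = s" for s by (cases s) (auto simp: to_nat_def of_num_def)
  have to_of: "to_nat (of_num n) = n" if "n \<in> {1..2}" for n
  proof -
    have "n = 1 \<or> n = 2" using that by auto
    then show ?thesis by (auto simp: to_nat_def of_num_def)
  qed
  have "single_conflict_colorable V E 2 \<longleftrightarrow> (\<forall>c. \<exists>\<phi>. satisfies E c \<phi>)"
  proof (intro iffI allI)
    fix c :: "'a \<Rightarrow> 'a set \<Rightarrow> colour"
    define d where "d v e = to_nat (c v e)" for v e
    assume "single_conflict_colorable V E 2"
    moreover have "local_partition V E 2 d"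
      using to_nat by (simp add: local_partition_def d_def)
    ultimately have "conflict_colorable V E 2 d"
      by (simp add: single_conflict_colorable_def)
    then obtain \<psi> where \<psi>: "\<forall>v\<in>V. \<psi> v \<in> {1..2}"
        and *: "\<not> (\<exists>x y. {x, y} \<in> E \<and> \<psi> x = d x {x, y} \<and> \<psi> y = d y {x, y})"
      unfolding conflict_colorable_def by blast
    have "satisfies E c (\<lambda>v. of_num (\<psi> v))"
      unfolding satisfies_def
    proof (intro allI impI notI)
      fix x y
      assume e: "{x, y} \<in> E" and eq: "violates c (\<lambda>v. of_num (\<psi> v)) x y"
      have "x \<in> V" "y \<in> V" using assms e by (auto simp: simple_graph_def)
      with \<psi> have "to_nat (of_num (\<psi> x)) = \<psi> x" "to_nat (of_num (\<psi> y)) = \<psi> y"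
        using to_of by blast+
      with eq have "\<psi> x = d x {x, y}" "\<psi> y = d y {x, y}"
        by (simp_all add: d_def violates_def)
      with * e show False by blast
    qed
    then show "\<exists>\<phi>. satisfies E c \<phi>" by blast
  next
    assume *: "\<forall>c. \<exists>\<phi>. satisfies E c \<phi>"
    show "single_conflict_colorable V E 2"
      unfolding single_conflict_colorable_def
    proof (intro allI impI)
      fix d :: "'a \<Rightarrow> 'a set \<Rightarrow> nat"
      obtain \<phi> where \<phi>: "satisfies E (\<lambda>v e. of_num (d v e)) \<phi>" using * by blast
      \<comment> \<open>Applying \<open>of_num\<close> to
        \<open>to_nat (\<phi> x) = d x {x, y}\<close> gives
        \<open>\<phi> x = of_num (d x {x, y})\<close>, so a conflict for \<open>d\<close> would be
        one for the translated partition.\<close>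
      have "\<not> (to_nat (\<phi> x) = d x {x, y} \<and> to_nat (\<phi> y) = d y {x, y})"
        if "{x, y} \<in> E" for x y
        using \<phi> that of_to unfolding satisfies_def violates_def by metis
      then show "conflict_colorable V E 2 d"
        unfolding conflict_colorable_def using to_nat
        by (intro exI[of _ "\<lambda>v. to_nat (\<phi> v)"]) blast
    qed
  qed
  then show ?thesis by (simp add: imposes_def)
qed

lemma satisfies_mono: "satisfies F' c \<phi> \<Longrightarrow> F \<subseteq> F' \<Longrightarrow> satisfies F c \<phi>"
  unfolding satisfies_def by blast

lemma satisfies_cong:
  assumes "\<And>v e. e \<in> F \<Longrightarrow> c v e = d v e"
  shows "satisfies F c \<phi> = satisfies F d \<phi>"
  unfolding satisfies_def violates_def by (intro iff_allI imp_cong refl) (simp add: assms)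

lemma imposes_mono:
  "imposes F R \<Longrightarrow> F \<subseteq> F' \<Longrightarrow> (\<And>\<phi>. R \<phi> \<Longrightarrow> R' \<phi>) \<Longrightarrow> imposes F' R'"
  unfolding imposes_def by (blast intro: satisfies_mono)

text \<open>Each edge carries a single clause. On disjoint edge sets the clauses can be chosen
  independently, so a partition copying \<open>c\<close> on \<open>F\<close> and \<open>d\<close> on
  \<open>G\<close> enforces both relations.\<close>

lemma imposes_Un:
  assumes "imposes F R" "imposes G S" "F \<inter> G = {}"
  shows "imposes (F \<union> G) (\<lambda>\<phi>. R \<phi> \<and> S \<phi>)"
proof -
  obtain c d where c: "\<And>\<phi>. satisfies F c \<phi> \<Longrightarrow> R \<phi>" and d: "\<And>\<phi>. satisfies G d \<phi> \<Longrightarrow> S \<phi>"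
    using assms unfolding imposes_def by blast
  let ?c = "\<lambda>v e. if e \<in> F then c v e else d v e"
  have "R \<phi> \<and> S \<phi>" if "satisfies (F \<union> G) ?c \<phi>" for \<phi>
  proof
    have "satisfies F ?c \<phi>" using that by (rule satisfies_mono) simp
    then show "R \<phi>" using c satisfies_cong[of F ?c c] by simp
    have "satisfies G ?c \<phi>" using that by (rule satisfies_mono) simp
    moreover have "satisfies G ?c \<phi> = satisfies G d \<phi>"
      by (rule satisfies_cong) (use assms(3) in auto)
    ultimately show "S \<phi>" using d by simp
  qed
  then show ?thesis unfolding imposes_def by blast
qed

lemma imposes_edge:
  assumes "x \<noteq> y"
  shows "imposes {{x, y}} (\<lambda>\<phi>. \<phi> x = a \<longrightarrow> \<phi> y = b)"
  unfolding imposes_def satisfies_def violates_def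
  \<comment> \<open>The clause forbids the pair \<open>(a, other b)\<close>, the only one that
    falsifies the implication.\<close>
  using assms by (intro exI[of _ "\<lambda>v e. if v = x then a else other b"]) (auto simp: eq_other_iff)

text \<open>Each edge carries the implication from the prescribed colour of its earlier end to that
  of its later end.\<close>

lemma imposes_path:
  "distinct p \<Longrightarrow> p \<noteq> [] \<Longrightarrow>
    imposes (path_edges p) (\<lambda>\<phi>. \<phi> (hd p) = f (hd p) \<longrightarrow> (\<forall>v\<in>set p. \<phi> v = f v))"
proof (induction p)
  case (Cons x p)
  show ?case
  proof (cases p)
    case Nil
    then show ?thesis by (simp add: imposes_def)
  next
    case (Cons y zs)
    have "imposes ({{x, y}} \<union> path_edges p)
      (\<lambda>\<phi>. (\<phi> x = f x \<longrightarrow> \<phi> y = f y) \<and> (\<phi> (hd p) = f (hd p) \<longrightarrow> (\<forall>v\<in>set p. \<phi> v = f v)))"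
    proof (rule imposes_Un)
      show "{{x, y}} \<inter> path_edges p = {}"
        using Cons.prems path_edges_subset_set[of "{x, y}" p] by auto
      show "imposes {{x, y}} (\<lambda>\<phi>. \<phi> x = f x \<longrightarrow> \<phi> y = f y)"
        using Cons.prems Cons by (intro imposes_edge) auto
      show "imposes (path_edges p) (\<lambda>\<phi>. \<phi> (hd p) = f (hd p) \<longrightarrow> (\<forall>v\<in>set p. \<phi> v = f v))"
        using Cons.prems Cons by (intro Cons.IH) auto
    qed
    then show ?thesis
    proof (rule imposes_mono)
      fix \<phi>
      assume *: "(\<phi> x = f x \<longrightarrow> \<phi> y = f y) \<and> (\<phi> (hd p) = f (hd p) \<longrightarrow> (\<forall>v\<in>set p. \<phi> v = f v))"
      have "hd p = y" using Cons by simp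
      with * show "\<phi> (hd (x # p)) = f (hd (x # p)) \<longrightarrow> (\<forall>v\<in>set (x # p). \<phi> v = f v)"
        unfolding list.set(2) list.sel(1) by blast
    qed (simp add: Cons)
  qed
qed simp

lemma imposes_path_ends:
  assumes "distinct p" "p \<noteq> []" "hd p \<noteq> last p"
  shows "imposes (path_edges p) (\<lambda>\<phi>. \<phi> (hd p) = s \<longrightarrow> \<phi> (last p) = t)"
proof -
  let ?f = "\<lambda>v. if v = hd p then s else t"
  have "imposes (path_edges p) (\<lambda>\<phi>. \<phi> (hd p) = ?f (hd p) \<longrightarrow> (\<forall>v\<in>set p. \<phi> v = ?f v))"
    using assms(1,2) by (rule imposes_path)
  then show ?thesis
    by (rule imposes_mono) (use assms in auto)
qed

section \<open>Cycles and internally disjoint paths\<close>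

text \<open>The first vertex is not repeated at the end of \<open>zs\<close>. For two vertices the
  closing edge would coincide with the path edge, hence the later bounds
  \<open>length zs \<ge> 3\<close>.\<close>

definition cycle_edges :: "'a list \<Rightarrow> 'a set set" where
  "cycle_edges zs = insert {last zs, hd zs} (path_edges zs)"

lemma cycle_edges_rotate:
  "cycle_edges (xs @ ys) = cycle_edges (ys @ xs)"
  by (cases "xs = [] \<or> ys = []") (auto simp: cycle_edges_def path_edges_append)

lemma cycle_starting_at:
  assumes "u \<in> set zs"
  obtains ys where "distinct ys = distinct zs" "length ys = length zs" "set ys = set zs"
    "hd ys = u" "cycle_edges ys = cycle_edges zs"
proof -
  obtain xs ys where zs: "zs = xs @ u # ys" using assms split_list by metis
  show thesis
    by (rule that[of "u # ys @ xs"]) (use cycle_edges_rotate[of xs "u # ys"] zs in auto)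
qed

lemma cycle_edges_subset_set: "zs \<noteq> [] \<Longrightarrow> e \<in> cycle_edges zs \<Longrightarrow> e \<subseteq> set zs"
  using path_edges_subset_set by (auto simp: cycle_edges_def)

text \<open>With \<open>u\<close> first in the list, the wrong colour \<open>other s\<close> at
  \<open>u\<close> is sent along the path to \<open>One\<close> at the last vertex, and the closing
  edge turns this into \<open>s\<close> at \<open>u\<close>, a contradiction.\<close>

lemma imposes_cycle:
  assumes "distinct zs" "length zs \<ge> 3" "u \<in> set zs"
  shows "imposes (cycle_edges zs) (\<lambda>\<phi>. \<phi> u = s)"
proof -
  obtain ys where dist: "distinct ys" and len: "length ys \<ge> 3"
    and ys: "hd ys = u" "cycle_edges ys = cycle_edges zs"
    using cycle_starting_at[OF assms(3)] assms(1,2) by metis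
  have "ys \<noteq> []" using len by auto
  have ne: "hd ys \<noteq> last ys" using dist len by (cases ys) auto
  have "{hd ys, last ys} \<notin> path_edges ys"
  proof
    assume "{hd ys, last ys} \<in> path_edges ys"
    then have "ys = [hd ys, last ys]" using ends_adjacent_on_path dist ne \<open>ys \<noteq> []\<close> by blast
    then have "length ys = length [hd ys, last ys]" by (rule arg_cong)
    then show False using len by simp
  qed
  then have "imposes (path_edges ys \<union> {{last ys, hd ys}})
    (\<lambda>\<phi>. (\<phi> (hd ys) = other s \<longrightarrow> \<phi> (last ys) = One) \<and> (\<phi> (last ys) = One \<longrightarrow> \<phi> (hd ys) = s))"
    using imposes_path_ends[OF dist \<open>ys \<noteq> []\<close> ne] imposes_edge[OF ne[symmetric]]
    by (intro imposes_Un) (auto simp: insert_commute)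
  then show ?thesis
    by (rule imposes_mono) (use ys in \<open>auto simp: cycle_edges_def eq_other_iff\<close>)
qed

text \<open>No ambient graph is mentioned, so the notion applies to subgraphs: two members of
  \<open>P\<close> form a cycle, three a theta graph.\<close>

definition disjoint_paths :: "'a \<Rightarrow> 'a \<Rightarrow> 'a list set \<Rightarrow> bool" where
  "disjoint_paths a b P \<longleftrightarrow> a \<noteq> b \<and>
     (\<forall>p\<in>P. p \<noteq> [] \<and> hd p = a \<and> last p = b \<and> distinct p) \<and>
     (\<forall>p\<in>P. \<forall>q\<in>P. p \<noteq> q \<longrightarrow> set p \<inter> set q = {a, b})"

text \<open>A common edge would lie in \<open>{a, b}\<close> and hence join the ends; a path
  containing that edge consists of it alone, so both paths would be \<open>[a, b]\<close>.\<close>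

lemma disjoint_paths_edges:
  assumes "disjoint_paths a b P" "p \<in> P" "q \<in> P" "p \<noteq> q"
  shows "path_edges p \<inter> path_edges q = {}"
proof (rule ccontr)
  assume "path_edges p \<inter> path_edges q \<noteq> {}"
  then obtain e where e: "e \<in> path_edges p" "e \<in> path_edges q" by blast
  have "e \<subseteq> {a, b}"
    using e[THEN path_edges_subset_set] assms unfolding disjoint_paths_def by blast
  moreover have "card e = card {a, b}"
    using card_path_edge[OF _ e(1)] assms by (simp add: disjoint_paths_def)
  ultimately have "e = {a, b}" by (intro card_subset_eq) auto
  then have "p = [a, b]" "q = [a, b]"
    using e assms ends_adjacent_on_path unfolding disjoint_paths_def by metis+
  with assms(4) show False by simp
qed

lemma cycle_as_disjoint_paths:
  assumes "distinct zs" "length zs \<ge> 3" "u \<in> set zs" "v \<in> set zs" "u \<noteq> v"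
  obtains p q where "p \<noteq> q" "disjoint_paths u v {p, q}" "set p \<union> set q = set zs"
    "path_edges p \<union> path_edges q = cycle_edges zs"
proof -
  obtain ys where dist: "distinct ys" and len: "length ys \<ge> 3" and set: "set ys = set zs"
    and ys: "hd ys = u" "cycle_edges ys = cycle_edges zs"
    using cycle_starting_at[OF assms(3)] assms(1,2) by metis
  obtain xs bs where "ys = xs @ v # bs" using assms set split_list by metis
  with ys(1) assms(5) obtain as where split: "ys = u # as @ v # bs" by (cases xs) auto
  \<comment> \<open>Cutting at \<open>v\<close> leaves two arcs; the second is reversed so that it
    too runs from \<open>u\<close> to \<open>v\<close>.\<close>
  let ?p = "u # as @ [v]" and ?q = "rev (v # bs @ [u])"
  show thesis
  proof (rule that[of ?p ?q])
    show "?p \<noteq> ?q"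
    proof
      assume "?p = ?q"
      then have "as = rev bs" by simp
      with split dist have "as = []" "bs = []" by (cases bs; auto)+
      with split len show False by simp
    qed
    show "disjoint_paths u v {?p, ?q}"
      using dist split unfolding disjoint_paths_def by auto
    show "set ?p \<union> set ?q = set zs" using split set by auto
    have "path_edges ys = path_edges ?p \<union> path_edges (v # bs)"
      using split path_edges_split[of "u # as" v bs] by simp
    moreover have "path_edges ?q = path_edges (v # bs) \<union> {{last ys, hd ys}}"
      unfolding path_edges_rev using split path_edges_append[of "v # bs" "[u]"] by simp
    ultimately show "path_edges ?p \<union> path_edges ?q = cycle_edges zs"
      using ys(2) by (auto simp: cycle_edges_def)
  qed
qed

section \<open>Theta graphs\<close>

lemma card_3_obtain:
  assumes "card P = 3" "p \<in> P"
  obtains q r where "P = {p, q, r}" "p \<noteq> q" "p \<noteq> r" "q \<noteq> r"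
proof -
  have "card (P - {p}) = 2" using assms by (simp add: card_Diff_singleton)
  then obtain q r where "P - {p} = {q, r}" "q \<noteq> r" by (auto simp: card_2_iff)
  then show thesis using that[of q r] assms(2) by blast
qed

text \<open>Needed for a further ear, both of whose ends may lie in the theta graph. The argument
  splits on whether some path contains both vertices; \<open>u\<close> and \<open>v\<close> may
  coincide.\<close>

lemma imposes_theta:
  assumes P: "disjoint_paths a b P" "card P = 3"
    and "u \<in> (\<Union>p\<in>P. set p)" "v \<in> (\<Union>p\<in>P. set p)"
  shows "imposes (\<Union>p\<in>P. path_edges p) (\<lambda>\<phi>. \<phi> u = f u \<and> \<phi> v = f v)"
proof -
  have path: "p \<noteq> []" "hd p = a" "last p = b" "distinct p" if "p \<in> P" for p
    using P that unfolding disjoint_paths_def by auto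
  have ne: "a \<noteq> b" using P unfolding disjoint_paths_def by auto
  have ends: "imposes (path_edges p) (\<lambda>\<phi>. \<phi> a = s \<longrightarrow> \<phi> b = t)" if "p \<in> P" for p s t
    using imposes_path_ends[of p s t] path[OF that] ne by simp
  have edges: "path_edges p \<inter> path_edges q = {}" if "p \<in> P" "q \<in> P" "p \<noteq> q" for p q
    using disjoint_paths_edges P that by metis
  show ?thesis
  proof (cases "\<exists>p\<in>P. u \<in> set p \<and> v \<in> set p")
    case True
    then obtain p where p: "p \<in> P" "u \<in> set p" "v \<in> set p" by blast
    then obtain q r where qr: "P = {p, q, r}" "p \<noteq> q" "p \<noteq> r" "q \<noteq> r"
      using card_3_obtain P by metis
    \<comment> \<open>The cycle formed by \<open>q\<close> and \<open>r\<close> fixes the colour of \<open>a\<close>, which is then propagated along \<open>p\<close>.\<close>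
    have "imposes ((path_edges q \<union> path_edges r) \<union> path_edges p)
      (\<lambda>\<phi>. ((\<phi> a = other (f a) \<longrightarrow> \<phi> b = One) \<and> (\<phi> a = other (f a) \<longrightarrow> \<phi> b = Two)) \<and>
        (\<phi> (hd p) = f (hd p) \<longrightarrow> (\<forall>v\<in>set p. \<phi> v = f v)))"
      using qr path[of p] edges[of q p] edges[of r p] edges[of q r]
      by (intro imposes_Un ends imposes_path) auto
    then show ?thesis
      by (rule imposes_mono) (use qr p path[of p] in \<open>auto simp: eq_other_iff\<close>)
  next
    case False
    then obtain p q where pq: "p \<in> P" "q \<in> P" "p \<noteq> q" "u \<in> set p" "v \<in> set q"
      using assms by blast
    have "a \<in> set p" "b \<in> set p" "a \<in> set q" "b \<in> set q"
      using path pq hd_in_set last_in_set by metis+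
    with pq False have ab: "u \<notin> {a, b}" "v \<notin> {a, b}" by auto
    have "\<exists>r. r \<in> P \<and> r \<noteq> p \<and> r \<noteq> q"
      using pq card_3_obtain[OF P(2) pq(1)] by (metis insertCI)
    then obtain r where r: "r \<in> P" "r \<noteq> p" "r \<noteq> q" by blast
    \<comment> \<open>The third path makes \<open>a\<close> or \<open>b\<close> take colour \<open>One\<close>; on \<open>p\<close> and \<open>q\<close> either choice is
      propagated from its end to the inner vertex.\<close>
    have inner: "imposes (path_edges p) (\<lambda>\<phi>. \<phi> a = One \<or> \<phi> b = One \<longrightarrow> \<phi> w = t)"
      if p: "p \<in> P" and w: "w \<in> set p" "w \<notin> {a, b}" for p w t
    proof -
      obtain xs ys where split: "p = xs @ w # ys" using w split_list by metis
      have "xs \<noteq> []" "ys \<noteq> []" using split path[OF p] w by auto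
      \<comment> \<open>The inner vertex \<open>w\<close> cuts \<open>p\<close> into a piece read
        from \<open>a\<close> and a piece read backwards from \<open>b\<close>, both ending in
        \<open>w\<close> and sharing no other vertex.\<close>
      let ?p1 = "xs @ [w]" and ?p2 = "rev (w # ys)"
      have hd: "hd ?p1 = a" "hd ?p2 = b"
        using path[OF p] split \<open>xs \<noteq> []\<close> \<open>ys \<noteq> []\<close> by (auto simp: hd_rev)
      have d: "distinct ?p1" "distinct ?p2" using path[OF p] split by auto
      have "path_edges ?p1 \<inter> path_edges ?p2 = {}"
      proof (rule ccontr)
        assume "path_edges ?p1 \<inter> path_edges ?p2 \<noteq> {}"
        then obtain e where e: "e \<in> path_edges ?p1" "e \<in> path_edges ?p2" by blast
        have "e \<subseteq> {w}"
          using e[THEN path_edges_subset_set] path(4)[OF p] split by auto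
        then have "card e \<le> 1" using card_mono[of "{w}" e] by simp
        then show False using card_path_edge[OF d(1) e(1)] by simp
      qed
      then have "imposes (path_edges ?p1 \<union> path_edges ?p2)
        (\<lambda>\<phi>. (\<phi> (hd ?p1) = One \<longrightarrow> \<phi> (last ?p1) = t) \<and> (\<phi> (hd ?p2) = One \<longrightarrow> \<phi> (last ?p2) = t))"
        using hd w d by (intro imposes_Un imposes_path_ends) auto
      moreover have "path_edges p = path_edges ?p1 \<union> path_edges ?p2"
        unfolding path_edges_rev split by (rule path_edges_split)
      ultimately show ?thesis
        using hd by (auto elim!: imposes_mono)
    qed
    have "imposes ((path_edges p \<union> path_edges q) \<union> path_edges r)
      (\<lambda>\<phi>. ((\<phi> a = One \<or> \<phi> b = One \<longrightarrow> \<phi> u = f u) \<and> (\<phi> a = One \<or> \<phi> b = One \<longrightarrow> \<phi> v = f v)) \<and> (\<phi> a = Two \<longrightarrow> \<phi> b = One))"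
      using pq r ab edges[of p q] edges[of p r] edges[of q r]
      by (intro imposes_Un inner ends) auto
    then show ?thesis
    proof (rule imposes_mono)
      show "path_edges p \<union> path_edges q \<union> path_edges r \<subseteq> (\<Union>p\<in>P. path_edges p)"
        using pq r by blast
    qed (metis colour.exhaust)
  qed
qed

section \<open>Ears\<close>

text \<open>
  An ear may return to \<open>W\<close> at its first vertex, or run into itself: it ends at the first
  vertex \<open>y\<close> that lies in \<open>W\<close> or has been visited before.
\<close>

definition ear :: "'a set set \<Rightarrow> 'a set \<Rightarrow> 'a list \<Rightarrow> 'a \<Rightarrow> bool" where
  "ear F W xs y \<longleftrightarrow> xs \<noteq> [] \<and> distinct xs \<and> set xs \<inter> W = {hd xs} \<and> path_edges xs \<subseteq> F \<and>
     {last xs, y} \<in> F \<and> last xs \<noteq> y \<and> {last xs, y} \<notin> path_edges xs \<and> y \<in> W \<union> set xs"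

text \<open>If \<open>w\<close> lies in \<open>W\<close>, the edge itself is an ear. Otherwise a
  longest path meeting \<open>W\<close> in its head only is taken: its last vertex has a second
  edge, whose far end lies in \<open>W\<close> or on the path by maximality.\<close>

lemma ear_at_edge:
  assumes "finite V" "\<And>e. e \<in> E \<Longrightarrow> e \<subseteq> V \<and> card e = 2"
    and deg: "\<And>v. v \<in> V \<Longrightarrow> card (incident_edges E v) \<ge> 2"
    and "u \<in> W" "{u, w} \<in> E" "{u, w} \<notin> F" "\<And>e. e \<in> F \<Longrightarrow> e \<subseteq> W"
  obtains xs y where "ear (E - F) W xs y"
proof (cases "w \<in> W")
  case True
  have "u \<noteq> w" using assms(2)[OF assms(5)] by auto
  with True assms have "ear (E - F) W [u] w" by (auto simp: ear_def)
  then show thesis using that by blast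
next
  case False
  \<comment> \<open>The head may be any vertex of \<open>W\<close>. Length at least 2 puts the last
    vertex outside \<open>W\<close>. Asking for edges in \<open>E\<close> is enough: edges of
    \<open>F\<close> lie within \<open>W\<close>, which the path meets only once.\<close>
  let ?Q = "\<lambda>xs. length xs \<ge> 2 \<and> distinct xs \<and> set xs \<inter> W = {hd xs} \<and> path_edges xs \<subseteq> E"
  have "?Q [u, w]" using False assms by auto
  moreover have "length xs < Suc (card V)" if "?Q xs" for xs
  proof -
    have "set xs \<subseteq> V"
      using path_edge_at_vertex[of _ xs] that assms(2) by blast
    then have "card (set xs) \<le> card V" using assms(1) by (rule card_mono[rotated])
    then show ?thesis using that by (simp add: distinct_card)
  qed
  ultimately obtain xs where xs: "?Q xs" and max: "\<And>ys. ?Q ys \<Longrightarrow> length ys \<le> length xs"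
    using ex_has_greatest_nat[of ?Q "[u, w]" length "Suc (card V)"] by blast
  have "xs \<noteq> []" using xs by auto
  \<comment> \<open>The edge from this predecessor is the only path edge at \<open>last xs\<close>,
    so the degree bound supplies an edge off the path.\<close>
  define z where "z = last (butlast xs)"
  have "butlast xs \<noteq> []" using xs by (cases xs; cases "tl xs") auto
  then have split: "xs = butlast (butlast xs) @ [z, last xs]"
    using \<open>xs \<noteq> []\<close> unfolding z_def by (metis append.assoc append_Cons append_Nil append_butlast_last_id)
  let ?e = "{z, last xs}"
  have e: "?e \<in> path_edges xs" by (subst split, subst path_edges_split) simp
  have only: "e = ?e" if "e \<in> path_edges xs" "last xs \<in> e" for e
  proof -
    have "e \<in> path_edges (butlast (butlast xs) @ [z]) \<union> {?e}"
      using that(1) by (subst (asm) split, subst (asm) path_edges_split) simp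
    moreover have "last xs \<notin> set (butlast (butlast xs) @ [z])"
      using xs split by (metis distinct_append append.assoc append_Cons append_Nil
          disjoint_iff list.set_intros(1))
    ultimately show ?thesis using path_edges_subset_set that(2) by blast
  qed
  have "last xs \<in> V" using e xs assms(2) by blast
  then have "card (incident_edges E (last xs)) \<ge> 2" by (rule deg)
  then have "\<not> incident_edges E (last xs) \<subseteq> {?e}"
    using card_mono[of "{?e}" "incident_edges E (last xs)"] by auto
  then obtain e' where e': "e' \<in> E" "last xs \<in> e'" "e' \<noteq> ?e"
    by (auto simp: incident_edges_def)
  then obtain y where y: "e' = {last xs, y}" "y \<noteq> last xs"
    using assms(2)[OF e'(1)] by (auto simp: card_2_iff)
  have new: "{last xs, y} \<notin> path_edges xs" using only e' y by blast
  have "last xs \<noteq> hd xs" using xs \<open>xs \<noteq> []\<close>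
    by (metis distinct.simps(2) hd_Cons_tl last_ConsR last_in_set length_Cons list.size(3) not_less_eq_eq numeral_2_eq_2 le0)
  then have "last xs \<notin> W" using xs \<open>xs \<noteq> []\<close> last_in_set by blast
  then have "{last xs, y} \<notin> F" using assms(7) by blast
  moreover have "path_edges xs \<inter> F = {}"
  proof (rule ccontr)
    assume "path_edges xs \<inter> F \<noteq> {}"
    then obtain d where d: "d \<in> path_edges xs" "d \<in> F" by blast
    then have "d \<subseteq> set xs \<inter> W" using path_edges_subset_set assms(7) by blast
    with xs have "card d \<le> 1" using card_mono[of "{hd xs}" d] by simp
    with d xs show False using card_path_edge by fastforce
  qed
  moreover have "y \<in> W \<union> set xs"
  proof (rule ccontr)
    assume "y \<notin> W \<union> set xs"
    then have "?Q (xs @ [y])"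
      using xs e' y \<open>xs \<noteq> []\<close> by (auto simp: path_edges_append)
    then show False using max by fastforce
  qed
  ultimately have "ear (E - F) W xs y"
    using xs e' y new \<open>xs \<noteq> []\<close> by (auto simp: ear_def)
  then show thesis using that by blast
qed

text \<open>For an edge outside \<open>F\<close>, either its end \<open>x\<close> is in
  \<open>W\<close>, or a path from \<open>W\<close> to \<open>x\<close> crosses out of
  \<open>W\<close>; the crossing edge is not contained in \<open>W\<close>, hence not in
  \<open>F\<close>.\<close>

lemma edge_leaving_subgraph:
  assumes "graph_connected V E" "\<And>e. e \<in> E \<Longrightarrow> e \<subseteq> V \<and> card e = 2"
    and "W \<subseteq> V" "W \<noteq> {}" "F \<subset> E" "\<And>e. e \<in> F \<Longrightarrow> e \<subseteq> W"
  obtains u w where "u \<in> W" "{u, w} \<in> E" "{u, w} \<notin> F"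
proof -
  obtain e where e: "e \<in> E" "e \<notin> F" using assms(5) by blast
  obtain x y where xy: "e = {x, y}" using assms(2)[OF e(1)] by (auto simp: card_2_iff)
  show thesis
  proof (cases "x \<in> W")
    case True
    then show ?thesis using that e xy by blast
  next
    case False
    obtain v where "v \<in> W" using assms(4) by blast
    moreover have "x \<in> V" using assms(2)[OF e(1)] xy by blast
    ultimately obtain p where "is_path V E v x p"
      using assms(1,3) unfolding graph_connected_def by blast
    with False \<open>v \<in> W\<close> obtain u w where "u \<in> W" "w \<notin> W" "{u, w} \<in> E"
      unfolding is_path_def using path_leaves_set[of p W] by blast
    then show ?thesis using that assms(6) by blast
  qed
qed

text \<open>The colour forced at the head travels along the ear, and the final edge then demands the
  wrong colour at \<open>y\<close>. But \<open>y\<close> already has colour \<open>f y\<close>,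
  through \<open>F\<close> or as a vertex of the ear.\<close>

lemma imposes_False_by_ear:
  assumes "ear (E - F) W xs y" "F \<subseteq> E"
    and "imposes F (\<lambda>\<phi>. \<phi> (hd xs) = f (hd xs) \<and> (y \<in> W \<longrightarrow> \<phi> y = f y))"
  shows "imposes E (\<lambda>_. False)"
proof -
  have xs: "xs \<noteq> []" "distinct xs" "path_edges xs \<subseteq> E - F" "{last xs, y} \<in> E - F" "last xs \<noteq> y"
    "{last xs, y} \<notin> path_edges xs" "y \<in> W \<union> set xs"
    using assms(1) by (auto simp: ear_def)
  have "imposes (F \<union> (path_edges xs \<union> {{last xs, y}}))
    (\<lambda>\<phi>. (\<phi> (hd xs) = f (hd xs) \<and> (y \<in> W \<longrightarrow> \<phi> y = f y)) \<and>
      (\<phi> (hd xs) = f (hd xs) \<longrightarrow> (\<forall>v\<in>set xs. \<phi> v = f v)) \<and>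
      (\<phi> (last xs) = f (last xs) \<longrightarrow> \<phi> y = other (f y)))"
    using xs by (intro imposes_Un imposes_path imposes_edge assms(3)) auto
  then show ?thesis
    by (rule imposes_mono) (use xs assms(2) in \<open>auto simp: eq_other_iff\<close>)
qed

section \<open>The characterization\<close>

text \<open>For \<open>W = {u}\<close> and no edges removed, an ear has to run into itself; its part
  from \<open>y\<close> on closes up to a cycle.\<close>

lemma exists_cycle:
  assumes "simple_graph V E" "V \<noteq> {}"
    and deg: "\<And>v. v \<in> V \<Longrightarrow> card (incident_edges E v) \<ge> 2"
  obtains zs where "distinct zs" "length zs \<ge> 3" "cycle_edges zs \<subseteq> E"
proof -
  have fin: "finite V" and edge: "\<And>e. e \<in> E \<Longrightarrow> e \<subseteq> V \<and> card e = 2"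
    using assms(1) by (auto simp: simple_graph_def)
  obtain u where "u \<in> V" using assms(2) by blast
  then have "incident_edges E u \<noteq> {}" using deg[of u] by auto
  then obtain e where "e \<in> E" "u \<in> e" by (auto simp: incident_edges_def)
  then obtain w where "{u, w} \<in> E" using edge[of e] by (auto simp: card_2_iff insert_commute)
  then obtain xs y where "ear (E - {}) {u} xs y"
    using ear_at_edge[OF fin edge deg, of u "{u}" w "{}"] by auto
  then have xs: "xs \<noteq> []" "distinct xs" "path_edges xs \<subseteq> E" "{last xs, y} \<in> E" "last xs \<noteq> y"
    "{last xs, y} \<notin> path_edges xs" "y \<in> set xs"
    by (auto simp: ear_def)
  obtain ps qs where split: "xs = ps @ y # qs" using xs(7) split_list by metis
  have sub: "path_edges (y # qs) \<subseteq> path_edges xs"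
    unfolding split path_edges_split[of ps y qs] by blast
  have "qs \<noteq> []" using xs(5) split by auto
  \<comment> \<open>With a single vertex after \<open>y\<close>, the closing edge would already be a
    path edge, which an ear excludes.\<close>
  moreover have "tl qs \<noteq> []"
  proof
    assume "tl qs = []"
    with \<open>qs \<noteq> []\<close> obtain z where "qs = [z]" by (cases qs) auto
    with sub split xs(6) show False by (auto simp: insert_commute)
  qed
  ultimately have "length (y # qs) \<ge> 3" by (cases qs; cases "tl qs") auto
  moreover have "cycle_edges (y # qs) \<subseteq> E"
    using sub split xs \<open>qs \<noteq> []\<close> by (auto simp: cycle_edges_def)
  moreover have "distinct (y # qs)" using xs split by simp
  ultimately show thesis using that by blast
qed

text \<open>Without isolated vertices the edges determine the vertex set, so it suffices to
  decompose \<open>E\<close>.\<close>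

lemma two_or_three_disjoint_pathsI:
  assumes "\<And>v. v \<in> V \<Longrightarrow> \<exists>e\<in>E. v \<in> e" "\<And>e. e \<in> E \<Longrightarrow> e \<subseteq> V"
    and P: "disjoint_paths a b P" "card P \<in> {2, 3}" and E: "E = (\<Union>p\<in>P. path_edges p)"
  shows "two_or_three_disjoint_paths V E"
proof -
  have ne: "a \<noteq> b" using P by (simp add: disjoint_paths_def)
  have path: "p \<noteq> []" "hd p = a" "last p = b" "distinct p" if "p \<in> P" for p
    using P that unfolding disjoint_paths_def by auto
  have "length p \<ge> 2" if "p \<in> P" for p
    using path[OF that] ne by (cases p; cases "tl p") auto
  then have "set p \<subseteq> V" if "p \<in> P" for p
    using that E assms(2) path_edge_at_vertex[of _ p] by blast
  then have isp: "is_path V E a b p" if "p \<in> P" for p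
    using that path E unfolding is_path_def by blast
  have "V \<subseteq> (\<Union>p\<in>P. set p)"
  proof
    fix v
    assume "v \<in> V"
    then obtain e p where "v \<in> e" "p \<in> P" "e \<in> path_edges p" using assms(1) E by blast
    then show "v \<in> (\<Union>p\<in>P. set p)" using path_edges_subset_set by blast
  qed
  then have V: "V = (\<Union>p\<in>P. set p)" using isp by (auto simp: is_path_def)
  obtain p where "p \<in> P" using P(2) by fastforce
  then have "a \<in> V" "b \<in> V" using V path[of p] hd_in_set last_in_set by blast+
  with ne P isp V E show ?thesis
    unfolding two_or_three_disjoint_paths_def disjoint_paths_def
    by (intro bexI[of _ a] bexI[of _ b] conjI exI[of _ P]) simp_all
qed

text \<open>A cycle controls one vertex, so an ear on it must return at a second vertex and
  completes a theta graph; that controls two vertices and admits no further ear.\<close>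

lemma two_or_three_disjoint_paths_if_not_imposes_False:
  assumes G: "simple_graph V E" "graph_connected V E"
    and deg: "\<And>v. v \<in> V \<Longrightarrow> card (incident_edges E v) \<ge> 2"
    and col: "\<not> imposes E (\<lambda>_. False)"
  shows "two_or_three_disjoint_paths V E"
proof -
  have fin: "finite V" and edge: "\<And>e. e \<in> E \<Longrightarrow> e \<subseteq> V \<and> card e = 2"
    using G(1) by (auto simp: simple_graph_def)
  have "\<exists>e\<in>E. v \<in> e" if "v \<in> V" for v
  proof -
    have "incident_edges E v \<noteq> {}" using deg[OF that] by auto
    then show ?thesis by (auto simp: incident_edges_def)
  qed
  then have pathsI: "two_or_three_disjoint_paths V E"
    if "disjoint_paths a b P" "card P \<in> {2, 3}" "E = (\<Union>p\<in>P. path_edges p)" for a b P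
    using two_or_three_disjoint_pathsI[OF _ _ that] edge by blast
  have ear: "\<exists>xs y. ear (E - F) W xs y"
    if "F \<subset> E" "W \<noteq> {}" "W \<subseteq> V" "\<And>e. e \<in> F \<Longrightarrow> e \<subseteq> W" for F W
    using edge_leaving_subgraph[OF G(2) edge that(3,2,1,4)] ear_at_edge[OF fin edge deg _ _ _ that(4)]
    by metis
  obtain zs where zs: "distinct zs" "length zs \<ge> 3" "cycle_edges zs \<subseteq> E"
    using exists_cycle G deg by (metis graph_connected_def)
  have "zs \<noteq> []" using zs by auto
  have zsV: "set zs \<subseteq> V"
  proof
    fix v assume "v \<in> set zs"
    then obtain e where "e \<in> path_edges zs" "v \<in> e"
      using path_edge_at_vertex[of v zs] zs by auto
    then show "v \<in> V" using zs(3) edge by (auto simp: cycle_edges_def)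
  qed
  show ?thesis
  proof (cases "cycle_edges zs = E")
    case True
    obtain u v where "u \<in> set zs" "v \<in> set zs" "u \<noteq> v"
      using zs by (cases zs; cases "tl zs") auto
    then obtain p q where "p \<noteq> q" "disjoint_paths u v {p, q}"
      "path_edges p \<union> path_edges q = cycle_edges zs"
      using cycle_as_disjoint_paths[OF zs(1,2)] by metis
    then show ?thesis using True by (intro pathsI[of u v "{p, q}"]) auto
  next
    case False
    then obtain xs y where xy: "ear (E - cycle_edges zs) (set zs) xs y"
      using ear[of "cycle_edges zs" "set zs"] zs \<open>zs \<noteq> []\<close> zsV cycle_edges_subset_set by blast
    then have xs: "xs \<noteq> []" "distinct xs" "set xs \<inter> set zs = {hd xs}"
      "path_edges xs \<subseteq> E - cycle_edges zs" "{last xs, y} \<in> E - cycle_edges zs"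
      "y \<in> set zs \<union> set xs"
      by (auto simp: ear_def)
    have hd: "hd xs \<in> set zs" using xs(3) by blast
    \<comment> \<open>If the ear ran into itself, \<open>hd xs\<close> would be the only vertex of
      the cycle whose colour has to be forced.\<close>
    have "y \<notin> set xs"
    proof
      assume "y \<in> set xs"
      then have eq: "y \<in> set zs \<Longrightarrow> y = hd xs" using xs(3) by blast
      have "imposes (cycle_edges zs)
        (\<lambda>\<phi>. \<phi> (hd xs) = One \<and> (y \<in> set zs \<longrightarrow> \<phi> y = One))"
        using imposes_cycle[OF zs(1,2) hd, of One] subset_refl
        by (rule imposes_mono) (use eq in auto)
      then have "imposes E (\<lambda>_. False)"
        using imposes_False_by_ear[OF xy zs(3), of "\<lambda>_. One"] by simp
      with col show False ..
    qed
    then have y: "y \<in> set zs" "hd xs \<noteq> y" using xs by auto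
    let ?r = "xs @ [y]"
    obtain p q where pq: "p \<noteq> q" "disjoint_paths (hd xs) y {p, q}"
      "set p \<union> set q = set zs" "path_edges p \<union> path_edges q = cycle_edges zs"
      using cycle_as_disjoint_paths[OF zs(1,2) hd y] by metis
    have r: "path_edges ?r = insert {last xs, y} (path_edges xs)"
      using xs(1) by (simp add: path_edges_append)
    have "{last xs, y} \<in> path_edges ?r" "{last xs, y} \<notin> path_edges p \<union> path_edges q"
      using r xs pq(4) by auto
    then have ne: "?r \<noteq> p" "?r \<noteq> q" by blast+
    have ends: "hd xs \<in> set p" "y \<in> set p" "hd xs \<in> set q" "y \<in> set q"
      using pq(2) hd_in_set last_in_set unfolding disjoint_paths_def by (metis insertCI)+
    have theta: "disjoint_paths (hd xs) y {p, q, ?r}"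
    proof -
      have "set ?r \<inter> set p = {hd xs, y}" "set ?r \<inter> set q = {hd xs, y}"
        using ends pq(3) xs(1,3) y(1) by auto
      then show ?thesis
        using pq(2) xs(1,2) \<open>y \<notin> set xs\<close> unfolding disjoint_paths_def by (auto simp: Int_commute)
    qed
    have card: "card {p, q, ?r} = 3" using pq(1) ne by auto
    let ?F = "\<Union>p\<in>{p, q, ?r}. path_edges p" and ?W = "\<Union>p\<in>{p, q, ?r}. set p"
    have "?F \<subseteq> E" using zs pq(4) r xs(4,5) by auto
    have "?W = set zs \<union> set xs" using pq(3) y(1) by auto
    moreover have "set xs \<subseteq> V"
    proof
      fix v assume "v \<in> set xs"
      then obtain e where "e \<in> path_edges ?r" "v \<in> e"
        using path_edge_at_vertex[of v ?r] xs(1) by (auto simp: Suc_le_eq)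
      moreover have "path_edges ?r \<subseteq> E" using r xs(4,5) by auto
      ultimately show "v \<in> V" using edge[of e] by auto
    qed
    ultimately have W: "?W \<subseteq> V" "?W \<noteq> {}" using zsV \<open>zs \<noteq> []\<close> by auto
    have "?F = E"
    proof (rule ccontr)
      assume "?F \<noteq> E"
      with \<open>?F \<subseteq> E\<close> have "?F \<subset> E" by blast
      moreover have "e \<subseteq> ?W" if "e \<in> ?F" for e using that path_edges_subset_set by blast
      ultimately obtain ys w where yw: "ear (E - ?F) ?W ys w" using ear[of ?F ?W] W by meson
      then have "hd ys \<in> ?W" unfolding ear_def by blast
      have "imposes ?F (\<lambda>\<phi>. \<phi> (hd ys) = One \<and> (w \<in> ?W \<longrightarrow> \<phi> w = One))"
      proof (cases "w \<in> ?W")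
        case True
        show ?thesis
          using imposes_theta[OF theta card \<open>hd ys \<in> ?W\<close> True, of "\<lambda>_. One"] subset_refl
          by (rule imposes_mono) auto
      next
        \<comment> \<open>Here \<open>w\<close> lies on the ear outside the theta graph, so only the
          head has to be forced, and \<open>imposes_theta\<close> is used with both vertices equal
          to \<open>hd ys\<close>.\<close>
        case False
        show ?thesis
          using imposes_theta[OF theta card \<open>hd ys \<in> ?W\<close> \<open>hd ys \<in> ?W\<close>, of "\<lambda>_. One"] subset_refl
          by (rule imposes_mono) (use False in auto)
      qed
      then have "imposes E (\<lambda>_. False)"
        using imposes_False_by_ear[OF yw \<open>?F \<subseteq> E\<close>, of "\<lambda>_. One"] by simp
      with col show False ..
    qed
    then show ?thesis using pathsI[OF theta] card by simp
  qed
qed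

section \<open>Sufficiency: colouring two or three disjoint paths\<close>

text \<open>One clause forbids one pair. If the rest of the path can fail only for
  \<open>(g, t0)\<close>, prefixing an edge leaves as possible failure only the new clause's colour
  at \<open>x\<close> together with \<open>t0\<close>.\<close>

lemma path_excludes_one_pair:
  assumes "distinct p" "p \<noteq> []" "hd p \<noteq> last p"
  shows "\<exists>st. \<forall>s t. (s, t) \<noteq> st \<longrightarrow> (\<exists>\<phi>. satisfies (path_edges p) c \<phi> \<and> \<phi> (hd p) = s \<and> \<phi> (last p) = t)"
  using assms
proof (induction p)
  case (Cons x p)
  then obtain y zs where p: "p = y # zs" by (cases p) auto
  let ?e = "{x, y}"
  have xy: "x \<noteq> y" using Cons.prems p by auto
  have sat: "satisfies (path_edges (x # p)) c \<phi> \<longleftrightarrow>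
      \<not> violates c \<phi> x y \<and> satisfies (path_edges p) c \<phi>" for \<phi>
  proof -
    have "violates c \<phi> u w \<longleftrightarrow> violates c \<phi> x y" if "{u, w} = ?e" for u w
      using that by (auto simp: doubleton_eq_iff violates_def insert_commute)
    then show ?thesis unfolding satisfies_def p path_edges_Cons_Cons insert_iff by blast
  qed
  show ?case
  proof (cases "zs = []")
    case True
    show ?thesis
    proof (intro exI[of _ "(c x ?e, c y ?e)"] allI impI)
      fix s t
      assume "(s, t) \<noteq> (c x ?e, c y ?e)"
      then show "\<exists>\<phi>. satisfies (path_edges (x # p)) c \<phi> \<and> \<phi> (hd (x # p)) = s \<and> \<phi> (last (x # p)) = t"
        using xy True unfolding sat
        by (intro exI[of _ "\<lambda>v. if v = x then s else t"]) (auto simp: p satisfies_def violates_def)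
    qed
  next
    case False
    have d: "distinct p" "p \<noteq> []" "hd p \<noteq> last p" "x \<notin> set p" using Cons.prems p False by auto
    obtain g t0 where IH: "\<And>s t. (s, t) \<noteq> (g, t0) \<Longrightarrow>
        \<exists>\<phi>. satisfies (path_edges p) c \<phi> \<and> \<phi> (hd p) = s \<and> \<phi> (last p) = t"
      using Cons.IH[OF d(1-3)] by (metis surj_pair)
    show ?thesis
    proof (intro exI[of _ "(c x ?e, t0)"] allI impI)
      fix s t
      assume st: "(s, t) \<noteq> (c x ?e, t0)"
      \<comment> \<open>The colour of \<open>y\<close>. If \<open>t = t0\<close>, then
        \<open>s\<close> differs from \<open>c x ?e\<close>, the first edge is satisfied, and
        \<open>y\<close> need only avoid \<open>g\<close>. Otherwise the rest accepts any colour of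
        \<open>y\<close>, and \<open>other (c y ?e)\<close> satisfies the first edge.\<close>
      define m where "m = (if t = t0 then other g else other (c y ?e))"
      have "(m, t) \<noteq> (g, t0)" by (auto simp: m_def)
      then obtain \<phi> where \<phi>: "satisfies (path_edges p) c \<phi>" "\<phi> (hd p) = m" "\<phi> (last p) = t"
        using IH by blast
      have "satisfies (path_edges p) c (\<phi>(x := s))"
        unfolding satisfies_def
      proof (intro allI impI)
        fix u w
        assume uw: "{u, w} \<in> path_edges p"
        then have "u \<noteq> x" "w \<noteq> x" using path_edges_subset_set d(4) by blast+
        then have "violates c (\<phi>(x := s)) u w = violates c \<phi> u w" by (simp add: violates_def)
        then show "\<not> violates c (\<phi>(x := s)) u w"
          using \<phi>(1) uw unfolding satisfies_def by blast
      qed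
      moreover have "\<not> violates c (\<phi>(x := s)) x y"
        using st \<phi>(2) xy by (auto simp: p m_def violates_def split: if_splits)
      moreover have "last p \<noteq> x" using d last_in_set by metis
      ultimately show "\<exists>\<phi>. satisfies (path_edges (x # p)) c \<phi> \<and> \<phi> (hd (x # p)) = s \<and> \<phi> (last (x # p)) = t"
        using \<phi>(3) d(2) unfolding sat by (intro exI[of _ "\<phi>(x := s)"]) auto
    qed
  qed
qed simp

lemma disjoint_paths_not_imposes_False:
  assumes P: "disjoint_paths a b P" "card P \<in> {2, 3}"
  shows "\<not> imposes (\<Union>p\<in>P. path_edges p) (\<lambda>_. False)"
proof -
  have "\<exists>\<phi>. satisfies (\<Union>p\<in>P. path_edges p) c \<phi>" for c
  proof -
    have ne: "a \<noteq> b" using P by (simp add: disjoint_paths_def)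
    have path: "p \<noteq> []" "hd p = a" "last p = b" "distinct p" if "p \<in> P" for p
      using P that unfolding disjoint_paths_def by auto
    have "\<forall>p\<in>P. \<exists>st. \<forall>s t. (s, t) \<noteq> st \<longrightarrow>
        (\<exists>\<phi>. satisfies (path_edges p) c \<phi> \<and> \<phi> a = s \<and> \<phi> b = t)"
      using path_excludes_one_pair[of _ c] path ne by metis
    then obtain st where st: "\<And>p s t. p \<in> P \<Longrightarrow> (s, t) \<noteq> st p \<Longrightarrow>
        \<exists>\<phi>. satisfies (path_edges p) c \<phi> \<and> \<phi> a = s \<and> \<phi> b = t"
      by metis
    have "finite P" using P(2) card.infinite by fastforce
    then have "card (st ` P) \<le> 3" using card_image_le[of P st] P(2) by auto
    moreover have "(UNIV :: (colour \<times> colour) set) = {One, Two} \<times> {One, Two}"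
      using colour.exhaust by auto
    from arg_cong[OF this, of card] have "card (UNIV :: (colour \<times> colour) set) = 4" by simp
    ultimately have "st ` P \<noteq> UNIV" by auto
    then obtain s t where "(s, t) \<notin> st ` P" by (metis UNIV_eq_I surj_pair)
    then have "\<forall>p\<in>P. \<exists>\<phi>. satisfies (path_edges p) c \<phi> \<and> \<phi> a = s \<and> \<phi> b = t"
      using st by blast
    then obtain \<psi> where \<psi>: "\<And>p. p \<in> P \<Longrightarrow> satisfies (path_edges p) c (\<psi> p)"
        "\<And>p. p \<in> P \<Longrightarrow> \<psi> p a = s" "\<And>p. p \<in> P \<Longrightarrow> \<psi> p b = t"
      by metis
    \<comment> \<open>The colourings of the single paths are glued by picking any path through
      \<open>v\<close>. The choice is immaterial: two paths meet only in \<open>a\<close> and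
      \<open>b\<close>, where all \<open>\<psi> p\<close> agree.\<close>
    define \<phi> where "\<phi> v = \<psi> (SOME p. p \<in> P \<and> v \<in> set p) v" for v
    have \<phi>: "\<phi> v = \<psi> p v" if "p \<in> P" "v \<in> set p" for p v
    proof -
      let ?q = "SOME p. p \<in> P \<and> v \<in> set p"
      have q: "?q \<in> P \<and> v \<in> set ?q" using that by (metis (mono_tags, lifting) someI_ex)
      show ?thesis
      proof (cases "?q = p")
        case False
        then have "v \<in> {a, b}" using P(1) q that unfolding disjoint_paths_def by blast
        then show ?thesis using \<psi> q that unfolding \<phi>_def by auto
      qed (simp add: \<phi>_def)
    qed
    have "satisfies (\<Union>p\<in>P. path_edges p) c \<phi>"
      unfolding satisfies_def
    proof (intro allI impI)
      fix x y
      assume "{x, y} \<in> (\<Union>p\<in>P. path_edges p)"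
      then obtain p where p: "p \<in> P" "{x, y} \<in> path_edges p" by blast
      then have "x \<in> set p" "y \<in> set p" using path_edges_subset_set by blast+
      then have "violates c \<phi> x y = violates c (\<psi> p) x y"
        using \<phi>[OF p(1)] by (simp add: violates_def)
      then show "\<not> violates c \<phi> x y"
        using \<psi>(1)[OF p(1)] p(2) unfolding satisfies_def by blast
    qed
    then show ?thesis by blast
  qed
  then show ?thesis by (simp add: imposes_def)
qed

theorem proposition2p3:
  fixes V :: "'a set" and E :: "'a set set"
  assumes "simple_graph V E"
    and "graph_connected V E"
    and "min_degree V E \<ge> 2"
  shows "single_conflict_colorable V E 2 \<longleftrightarrow> two_or_three_disjoint_paths V E"
proof
  have deg: "card (incident_edges E v) \<ge> 2" if "v \<in> V" for v
  proof -
    have "Min (vertex_degree E ` V) \<le> vertex_degree E v"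
      using that assms(1) by (intro Min_le) (auto simp: simple_graph_def)
    then show ?thesis using assms(3) by (simp add: min_degree_def vertex_degree_def)
  qed
  assume "single_conflict_colorable V E 2"
  then have "\<not> imposes E (\<lambda>_. False)"
    using single_conflict_2_colorable_iff[OF assms(1)] by simp
  then show "two_or_three_disjoint_paths V E"
    using two_or_three_disjoint_paths_if_not_imposes_False[OF assms(1,2) deg] by blast
next
  assume "two_or_three_disjoint_paths V E"
  then obtain a b P where P: "a \<noteq> b" "card P \<in> {2, 3}" "\<forall>p\<in>P. is_path V E a b p"
    "\<forall>p\<in>P. \<forall>q\<in>P. p \<noteq> q \<longrightarrow> set p \<inter> set q = {a, b}" and E: "E = (\<Union>p\<in>P. path_edges p)"
    unfolding two_or_three_disjoint_paths_def by blast
  have "disjoint_paths a b P"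
    unfolding disjoint_paths_def
  proof (intro conjI P(1) P(4) ballI)
    fix p
    assume "p \<in> P"
    with P(3) have "is_path V E a b p" ..
    then show "p \<noteq> []" "hd p = a" "last p = b" "distinct p" by (simp_all add: is_path_def)
  qed
  from this P(2) have "\<not> imposes E (\<lambda>_. False)"
    unfolding E by (rule disjoint_paths_not_imposes_False)
  then show "single_conflict_colorable V E 2"
    using single_conflict_2_colorable_iff[OF assms(1)] by simp
qed

end
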